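(* Let $\omega$ be a factor of the Fibonacci sequence $F_\infty$ with $\omega\notin\{\varepsilon,ab,ba,aba\}$. Then: (1) $\omega$ has a unique singular kernel $sk(\omega)$: among the singular words that are factors of $\omega$ there is exactly one of maximal length, and this word occurs in $\omega$ exactly once; (2) consequently $\omega$ has a unique decomposition $\omega=\mu_1(\omega)\, sk(\omega)\,\mu_2(\omega)$ with (possibly empty) words $\mu_1(\omega),\mu_2(\omega)$.
   Context: Words are over the alphabet $\{a,b\}$; $\varepsilon$ is the empty word. A factor of a (finite or infinite) word is a finite block of consecutive letters of it. Let $\sigma$ be the morphism $\sigma(a)=ab$, $\sigma(b)=a$, put $F_k=\sigma^k(a)$ for $k\ge 0$, and let $F_\infty=\lim_{k\to\infty}F_k=abaababaabaab\cdots$ be the Fibonacci sequence. For $k\ge0$ let $\alpha\in\{a,b\}$ be the last letter of $F_k$ and $\beta$ the other letter. The singular words are $s_{-1}=a$ and, for $k\ge 0$, $s_k=\beta F_k\alpha^{-1}$, i.e. the word obtained from $F_k$ by deleting its last letter $\alpha$ and putting $\beta$ in front (so $s_0=b$, $s_1=aa$, $s_2=bab$, $s_3=aabaa$). The singular kernel $sk(\omega)$ of a factor $\omega$ is the longest singular word that is a factor of $\omega$. *)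

theory Defs
  imports Main "HOL-Library.Sublist"
begin

datatype letter = A | B

fun other :: "letter \<Rightarrow> letter" where
  "other A = B"
| "other B = A"

fun sigma_letter :: "letter \<Rightarrow> letter list" where
  "sigma_letter A = [A, B]"
| "sigma_letter B = [A]"

definition sigma :: "letter list \<Rightarrow> letter list" where
  "sigma w = concat (map sigma_letter w)"

definition F :: "nat \<Rightarrow> letter list" where
  "F k = (sigma ^^ k) [A]"

text \<open>An infinite word is a function from \<^typ>\<open>nat\<close>. A sequence of finite words converges
  to it if every position is eventually present and has the right letter.\<close>

definition words_tendsto :: "(nat \<Rightarrow> 'a list) \<Rightarrow> (nat \<Rightarrow> 'a) \<Rightarrow> bool" where
  "words_tendsto W u \<longleftrightarrow> (\<forall>n. \<exists>K. \<forall>k\<ge>K. n < length (W k) \<and> W k ! n = u n)"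

definition F_inf :: "nat \<Rightarrow> letter" where
  "F_inf = (THE u. words_tendsto F u)"

definition seq_factor :: "'a list \<Rightarrow> (nat \<Rightarrow> 'a) \<Rightarrow> bool" where
  "seq_factor w u \<longleftrightarrow> (\<exists>i. w = map u [i..<i + length w])"

definition occurs_at :: "'a list \<Rightarrow> 'a list \<Rightarrow> nat \<Rightarrow> bool" where
  "occurs_at v w i \<longleftrightarrow> i + length v \<le> length w \<and> take (length v) (drop i w) = v"

text \<open>Only indices \<open>k \<ge> -1\<close> are meaningful; \<^term>\<open>singular_words\<close> ranges over exactly these.\<close>

definition singular :: "int \<Rightarrow> letter list" where
  "singular k = (if k = -1 then [A] else other (last (F (nat k))) # butlast (F (nat k)))"

definition singular_words :: "letter list set" where
  "singular_words = singular ` {-1..}"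

definition is_singular_kernel :: "letter list \<Rightarrow> letter list \<Rightarrow> bool" where
  "is_singular_kernel s w \<longleftrightarrow> s \<in> singular_words \<and> sublist s w \<and>
     (\<forall>t \<in> singular_words. sublist t w \<longrightarrow> length t \<le> length s)"

definition sk :: "letter list \<Rightarrow> letter list" where
  "sk w = (THE s. is_singular_kernel s w)"

text \<open>The limit defining \<^term>\<open>F_inf\<close> exists and is unique.\<close>

lemma words_tendsto_unique:
  assumes "words_tendsto W u" and "words_tendsto W v"
  shows "u = v"
proof
  fix n
  obtain K where K: "\<forall>k\<ge>K. W k ! n = u n"
    using assms(1) unfolding words_tendsto_def by blast
  obtain L where L: "\<forall>k\<ge>L. W k ! n = v n"
    using assms(2) unfolding words_tendsto_def by blast
  from K have "W (max K L) ! n = u n" by simp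
  moreover from L have "W (max K L) ! n = v n" by simp
  ultimately show "u n = v n" by simp
qed

lemma sigma_append: "sigma (u @ v) = sigma u @ sigma v"
  by (simp add: sigma_def)

lemma F_Suc: "F (Suc k) = sigma (F k)"
  by (simp add: F_def)

lemma F_Suc_extends: "\<exists>v. v \<noteq> [] \<and> F (Suc k) = F k @ v"
proof (induction k)
  case 0
  show ?case by (simp add: F_def sigma_def)
next
  case (Suc k)
  then obtain v where v: "v \<noteq> []" "F (Suc k) = F k @ v" by blast
  have "sigma v \<noteq> []"
    using v(1) by (cases v; cases "hd v") (auto simp: sigma_def)
  moreover have "F (Suc (Suc k)) = F (Suc k) @ sigma v"
    using v(2) by (metis F_Suc sigma_append)
  ultimately show ?case by blast
qed

lemma length_F: "n < length (F n)"
proof (induction n)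
  case 0
  show ?case by (simp add: F_def)
next
  case (Suc n)
  obtain v where "v \<noteq> []" "F (Suc n) = F n @ v" using F_Suc_extends by blast
  with Suc show ?case by (cases v) auto
qed

lemma F_prefix: "j \<le> k \<Longrightarrow> prefix (F j) (F k)"
proof (induction k rule: dec_induct)
  case (step k)
  then show ?case using F_Suc_extends[of k] by auto
qed simp

lemma F_tendsto: "words_tendsto F (\<lambda>n. F n ! n)"
  unfolding words_tendsto_def
proof (intro allI exI impI)
  fix n k :: nat
  assume "n \<le> k"
  then obtain v where "F k = F n @ v" using F_prefix prefixE by metis
  then show "n < length (F k) \<and> F k ! n = F n ! n"
    using length_F[of n] by (simp add: nth_append)
qed

lemma words_tendsto_F_inf: "words_tendsto F F_inf"
  unfolding F_inf_def by (rule theI[where P = "words_tendsto F", OF F_tendsto]) (rule words_tendsto_unique[OF _ F_tendsto])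

lemma F_inf_eq: "F_inf n = F n ! n"
  using words_tendsto_unique[OF words_tendsto_F_inf F_tendsto] by (rule fun_cong)

end

theory Submission
  imports Defs
begin

text \<open>
  The longest singular word in a factor cannot occur twice there, because in the Fibonacci
  sequence any two occurrences of \<open>s\<^sub>k\<close> (with \<open>k \<ge> 0\<close>) span a longer singular word: any
  factor that begins and ends with \<open>s\<^sub>k\<close>, at different places, contains
  \<open>s\<^sub>k\<^sub>+\<^sub>1\<close> or \<open>s\<^sub>k\<^sub>+\<^sub>2\<close> (\<open>repeated_sing\<close>). Typical instances are
  \<open>s\<^sub>k s\<^sub>k\<^sub>-\<^sub>1 s\<^sub>k = s\<^sub>k\<^sub>+\<^sub>2\<close> and \<open>s\<^sub>k s\<^sub>k\<^sub>+\<^sub>1 s\<^sub>k\<close>.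

  This is proved by induction on \<open>k\<close>. For \<open>k = 0\<close>, a factor \<open>b...b\<close> starts with \<open>bab\<close> or
  \<open>baa\<close>, since \<open>bb\<close> never occurs. The step is desubstitution. Up to one letter at the boundary,
  \<open>s\<^sub>k\<^sub>+\<^sub>1\<close> is \<open>\<sigma>(s\<^sub>k)\<close>: a singular word \<open>b...b\<close> becomes \<open>\<sigma>(b...b)a\<close>, and a singular word
  \<open>a...a\<close> becomes \<open>\<sigma>(a...a)\<close> without its first letter. The same operation
  \<open>lift_sing\<close> makes sense for every word whose first and last letters agree. It preserves
  the factor relation (\<open>lift_sing_mono\<close>), and a factor that begins and ends with
  \<open>s\<^sub>k\<^sub>+\<^sub>1\<close> is the lift of a shorter factor that begins and ends with \<open>s\<^sub>k\<close>
  (\<open>lift_sing_desubstitute\<close>), because the cutting points of a \<open>\<sigma>\<close>-image can be read off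
  locally: a cut before an \<open>a\<close> is always a cut between blocks.

  It remains to compare lengths. The words \<open>s\<^sub>0, s\<^sub>1, s\<^sub>2, ...\<close> have strictly increasing lengths,
  and only \<open>s\<^sub>-\<^sub>1 = a\<close> and \<open>s\<^sub>0 = b\<close> tie. So a factor containing \<open>s\<^sub>1 = aa\<close> or \<open>s\<^sub>2 = bab\<close>
  has exactly one kernel, occurring once. The few nonempty factors that contain neither are \<open>a\<close> and
  \<open>b\<close>, which are their own kernels, and the exceptions \<open>ab\<close>, \<open>ba\<close>, \<open>aba\<close>, in which
  \<open>a\<close> and \<open>b\<close> tie.
\<close>

section \<open>Desubstitution\<close>

lemma sigma_simps [simp]:
  "sigma [] = []" "sigma (A # u) = A # B # sigma u" "sigma (B # u) = A # sigma u"
  by (simp_all add: sigma_def)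

lemma sigma_starts_with_A: "u \<noteq> [] \<Longrightarrow> \<exists>t. sigma u = A # t"
  by (cases u; cases "hd u") auto

lemma sigma_last: "u \<noteq> [] \<Longrightarrow> last (sigma u) = other (last u)"
proof (induction u rule: rev_induct)
  case (snoc x u)
  then show ?case by (cases x) (auto simp: sigma_append)
qed simp

text \<open>The blocks \<open>ab\<close> and \<open>a\<close> form a suffix code, so decoding from the right is deterministic;
  from the left it would need one letter of lookahead.\<close>

lemma sigma_inj: "sigma u = sigma v \<Longrightarrow> u = v"
proof (induction u arbitrary: v rule: rev_induct)
  case Nil
  then show ?case by (cases v; cases "hd v") auto
next
  case (snoc x u)
  then obtain y v' where v: "v = v' @ [y]"
    by (cases v rule: rev_cases; cases x) (auto simp: sigma_append)
  with snoc.prems show ?case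
    using snoc.IH by (cases x; cases y) (auto simp: sigma_append)
qed

text \<open>Every block starts with \<open>a\<close> and has no other \<open>a\<close>, so a cut in front of an \<open>a\<close> never
  splits a block.\<close>

lemma sigma_cut:
  assumes "sigma u = p @ q" and "q = [] \<or> hd q = A"
  shows "\<exists>u1 u2. u = u1 @ u2 \<and> sigma u1 = p \<and> sigma u2 = q"
  using assms
proof (induction u arbitrary: p)
  case (Cons x u)
  show ?case
  proof (cases "p = []")
    case True
    with Cons.prems show ?thesis by (metis append_Nil sigma_simps(1))
  next
    case False
    then obtain p' where p: "p = sigma [x] @ p'" "sigma u = p' @ q"
      using Cons.prems by (cases x; cases p; cases "tl p") auto
    obtain u1 u2 where "u = u1 @ u2" "sigma u1 = p'" "sigma u2 = q"
      using Cons.IH[OF p(2) Cons.prems(2)] by blast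
    then have "x # u = (x # u1) @ u2 \<and> sigma (x # u1) = p \<and> sigma u2 = q"
      using p(1) by (cases x) auto
    then show ?thesis by blast
  qed
qed simp

lemma sigma_isolates_B:
  assumes "sigma u = p @ B # q"
  shows "p \<noteq> [] \<and> last p = A" and "q = [] \<or> hd q = A"
proof -
  have "(p \<noteq> [] \<and> last p = A) \<and> (q = [] \<or> hd q = A)"
    using assms
  proof (induction u arbitrary: p)
    case (Cons x u)
    show ?case
    proof (cases "\<exists>p'. p = sigma [x] @ p'")
      case True
      then obtain p' where p: "p = sigma [x] @ p'" by blast
      with Cons.prems have "sigma u = p' @ B # q" by (cases x) auto
      with Cons.IH p show ?thesis by auto
    next
      case False
      with Cons.prems have "p = [A]" "q = sigma u"
        by (cases x; cases p; cases "tl p"; auto)+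
      then show ?thesis using sigma_starts_with_A[of u] by (cases "u = []") auto
    qed
  qed simp
  then show "p \<noteq> [] \<and> last p = A" and "q = [] \<or> hd q = A" by blast+
qed

section \<open>Lifting words along the substitution\<close>

text \<open>The map that takes each singular word to the next one. On words with equal first and last
  letters it produces again such a word, with the other letter at its ends; this is why the letter
  \<open>a\<close> is alternately added at the right and removed at the left.\<close>

definition lift_sing :: "letter list \<Rightarrow> letter list" where
  "lift_sing x = (if hd x = B then sigma x @ [A] else tl (sigma x))"

definition two_ended :: "letter list \<Rightarrow> bool" where
  "two_ended x \<longleftrightarrow> x \<noteq> [] \<and> hd x = last x"

lemma two_ended_lift: "two_ended x \<Longrightarrow> two_ended (lift_sing x) \<and> hd (lift_sing x) = other (hd x)"
  by (cases x; cases "hd x")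
     (use sigma_last[of x] in \<open>auto simp: two_ended_def lift_sing_def split: if_splits\<close>)

text \<open>Deleting a leading \<open>a\<close> or appending one could only hurt at the ends of the larger word. If
  its first letter is deleted while the smaller word gets an \<open>a\<close> appended, then the end letters of
  the two words differ, so the smaller word lies strictly inside and has room on both sides. In all
  other cases an \<open>a\<close> appended to the smaller word is found as the first letter of the next block or as the \<open>a\<close> appended to
  the larger word.\<close>

lemma lift_sing_mono:
  assumes "two_ended x" "two_ended v" "sublist x v"
  shows "sublist (lift_sing x) (lift_sing v)"
proof -
  obtain p q where v: "v = p @ x @ q" using assms(3) by (auto simp: sublist_def)
  have ne: "x \<noteq> []" "v \<noteq> []" using assms by (auto simp: two_ended_def)
  obtain t where t: "sigma x = A # t" using sigma_starts_with_A ne by blast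
  have sv: "sigma v = sigma p @ sigma x @ sigma q" by (simp add: v sigma_append)
  show ?thesis
  proof (cases "hd x")
    case A
    then have lx: "lift_sing x = t" by (simp add: lift_sing_def t)
    show ?thesis
    proof (cases "hd v")
      case A
      have "lift_sing v = tl (sigma p @ [A]) @ t @ sigma q"
        using A sv t by (cases "sigma p") (auto simp: lift_sing_def)
      then show ?thesis by (simp add: lx)
    next
      case B
      have "lift_sing v = (sigma p @ [A]) @ t @ (sigma q @ [A])"
        using B sv t by (auto simp: lift_sing_def)
      then show ?thesis by (metis lx sublist_appendI)
    qed
  next
    case B
    then have lx: "lift_sing x = sigma x @ [A]" by (simp add: lift_sing_def)
    show ?thesis
    proof (cases "hd v")
      case A
      \<comment> \<open>The end letters of \<open>v\<close> and \<open>x\<close> differ, so \<open>x\<close> lies strictly inside \<open>v\<close>.\<close>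
      have "p \<noteq> []" "q \<noteq> []"
        using A B assms(1,2) v by (auto simp: two_ended_def)
      then obtain p' q' where "sigma p = A # p'" "sigma q = A # q'"
        using sigma_starts_with_A by blast
      then have "lift_sing v = p' @ (sigma x @ [A]) @ q'"
        using A sv by (simp add: lift_sing_def)
      then show ?thesis by (metis lx sublist_appendI)
    next
      case B
      obtain r where "sigma q @ [A] = A # r"
        using sigma_starts_with_A[of q] by (cases "q = []") auto
      then have "lift_sing v = sigma p @ (sigma x @ [A]) @ r"
        using B sv by (simp add: lift_sing_def)
      then show ?thesis by (metis lx sublist_appendI)
    qed
  qed
qed

text \<open>The inductive step runs on this converse of lifting. If the lift of \<open>x\<close> ends in \<open>b\<close>, then \<open>w\<close>
  starts and ends with \<open>b\<close>, so inside \<open>\<sigma>(u)\<close> it is preceded by an \<open>a\<close>; adding this \<open>a\<close> gives a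
  word made of complete blocks. If the lift ends in the extra \<open>a\<close>, removing that letter from \<open>w\<close>
  has the same effect. The decoded word inherits the two positions of \<open>x\<close>, because both
  boundaries of \<open>\<sigma>(x)\<close> are cuts between blocks as well.\<close>

lemma lift_sing_desubstitute:
  assumes "sublist w (sigma u)" and "two_ended x"
    and "w = lift_sing x @ y" and "w = z @ lift_sing x" and "z \<noteq> []"
  shows "\<exists>v y' z'. sublist v u \<and> w = lift_sing v \<and> v = x @ y' \<and> v = z' @ x \<and> z' \<noteq> []"
proof -
  obtain p q where u: "sigma u = p @ w @ q" using assms(1) by (auto simp: sublist_def)
  have x: "x \<noteq> []" "hd x = last x" using assms(2) by (auto simp: two_ended_def)
  obtain t where t: "sigma x = A # t" using sigma_starts_with_A x by blast
  show ?thesis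
  proof (cases "hd x")
    case B
    have l: "lift_sing x = sigma x @ [A]" using B by (simp add: lift_sing_def)
    let ?c = "z @ sigma x"
    have w: "w = ?c @ [A]" using assms(4) l by simp
    have pre: "?c @ [A] = sigma x @ A # y" using assms(3) l w by simp
    have hc: "hd (?c @ [A] @ q) = A" using pre t by (cases z) auto
    obtain u1 u' where 1: "u = u1 @ u'" "sigma u' = ?c @ [A] @ q"
      using sigma_cut[of u p "?c @ [A] @ q"] u w hc by auto
    obtain v u2 where 2: "u' = v @ u2" "sigma v = ?c"
      using sigma_cut[of u' ?c "[A] @ q"] 1(2) by auto
    \<comment> \<open>From \<open>ra = ay\<close> it follows that \<open>r\<close> is empty or starts with \<open>a\<close>, so \<open>\<sigma>(x)\<close> ends at a cut.\<close>
    obtain r where r: "?c = sigma x @ r" "r @ [A] = A # y"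
    proof (cases y rule: rev_cases)
      case Nil
      with pre have "?c = sigma x" by simp
      with Nil that[of "[]"] show ?thesis by simp
    next
      case (snoc y' l)
      with pre have "?c @ [A] = (sigma x @ A # y') @ [l]" by simp
      then have "?c = sigma x @ A # y'" "l = A" by (simp_all only: append1_eq_conv)
      with snoc that[of "A # y'"] show ?thesis by simp
    qed
    have "r = [] \<or> hd r = A" using r(2) by (cases r) auto
    then obtain y' where 3: "v = x @ y'"
      using sigma_cut[of v "sigma x" r] 2(2) r(1) sigma_inj by metis
    obtain z' where 4: "v = z' @ x" "sigma z' = z"
      using sigma_cut[of v z "sigma x"] 2(2) t sigma_inj by (metis list.sel(1))
    have "hd v = B" using 3 x B by simp
    then have "w = lift_sing v" using w 2(2) by (simp add: lift_sing_def)
    moreover have "sublist v u" using 1 2 by simp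
    moreover have "z' \<noteq> []" using 4 assms(5) by auto
    ultimately show ?thesis using 3 4 by blast
  next
    case A
    have l: "lift_sing x = t" using A by (simp add: lift_sing_def t)
    have te: "two_ended t" "hd t = B" using two_ended_lift[OF assms(2)] l A by auto
    then obtain t1 t2 where t12: "t = B # t1" "t = t2 @ [B]"
      by (metis append_butlast_last_id list.collapse two_ended_def)
    \<comment> \<open>The first \<open>b\<close> of \<open>w\<close> must be the second letter of a block \<open>ab\<close>.\<close>
    have "sigma u = p @ B # (t1 @ y @ q)" using u assms(3) l t12(1) by simp
    then obtain p' where p: "p = p' @ [A]"
      using sigma_isolates_B(1) by (metis append_butlast_last_id)
    have "sigma u = (p @ z @ t2) @ B # q" using u assms(4) l t12(2) by simp
    then have q: "q = [] \<or> hd q = A" using sigma_isolates_B(2) by blast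
    obtain u1 u' where 1: "u = u1 @ u'" "sigma u' = (A # w) @ q"
      using sigma_cut[of u p' "(A # w) @ q"] u p by auto
    obtain v u2 where 2: "u' = v @ u2" "sigma v = A # w"
      using sigma_cut[of u' "A # w" q] 1(2) q by blast
    have "sigma v = sigma x @ y" using 2(2) assms(3) l t by simp
    moreover have "y = [] \<or> hd y = A"
    proof -
      have "sigma v = (A # t2) @ B # y" using 2(2) assms(3) l t12(2) by simp
      then show ?thesis using sigma_isolates_B(2) by blast
    qed
    ultimately obtain y' where 3: "v = x @ y'"
      using sigma_cut[of v "sigma x" y] sigma_inj by metis
    \<comment> \<open>\<open>az\<close> precedes a \<open>b\<close>, hence ends with the \<open>a\<close> of the block containing it; that \<open>a\<close> belongs
      to the final copy of \<open>\<sigma>(x)\<close>, and \<open>z0\<close> is what precedes this copy.\<close>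
    obtain z0 where z0: "A # z = z0 @ [A]" "z0 \<noteq> []"
    proof -
      have "sigma v = (A # z) @ B # t1" using 2(2) assms(4) l t12(1) by simp
      then have "last (A # z) = A" using sigma_isolates_B(1) by blast
      then show ?thesis using that[of "butlast (A # z)"] assms(5)
        by (metis append_butlast_last_id butlast.simps(2) list.distinct(1))
    qed
    have "sigma v = z0 @ sigma x" using 2(2) assms(4) l t z0(1)
      by (metis append.assoc append_Cons append_Nil)
    then obtain z' where 4: "v = z' @ x" "sigma z' = z0"
      using sigma_cut[of v z0 "sigma x"] t sigma_inj by (metis list.sel(1))
    have "hd v = A" using 3 x A by simp
    then have "w = lift_sing v" using 2(2) by (simp add: lift_sing_def)
    moreover have "sublist v u" using 1 2 by simp
    moreover have "z' \<noteq> []" using 4 z0 by auto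
    ultimately show ?thesis using 3 4 by blast
  qed
qed

section \<open>Singular words\<close>

text \<open>The singular words of index at least 0; the word \<open>s\<^sub>-\<^sub>1 = a\<close> is kept apart, since it is
  no shorter than \<open>s\<^sub>0 = b\<close> and can recur without forcing a longer singular word.\<close>

abbreviation sing :: "nat \<Rightarrow> letter list" where
  "sing k \<equiv> singular (int k)"

lemma F_nonempty: "F k \<noteq> []"
  using length_F[of k] by auto

lemma sing_eq: "sing k = other (last (F k)) # butlast (F k)"
  by (simp add: singular_def)

text \<open>Both cases for the last letter of \<open>F\<^sub>k = f c\<close> come down to
  \<open>F\<^sub>k\<^sub>+\<^sub>1 = \<sigma>(f) \<sigma>(c)\<close>: if \<open>c = b\<close>, then \<open>s\<^sub>k = a f\<close> and
  \<open>s\<^sub>k\<^sub>+\<^sub>1 = b \<sigma>(f)\<close>; if \<open>c = a\<close>, then \<open>s\<^sub>k = b f\<close> and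
  \<open>s\<^sub>k\<^sub>+\<^sub>1 = a \<sigma>(f) a\<close>.\<close>

lemma sing_Suc: "sing (Suc k) = lift_sing (sing k)"
proof -
  obtain f c where f: "F k = f @ [c]" using F_nonempty by (metis rev_exhaust)
  then have "F (Suc k) = sigma f @ sigma [c]" by (simp add: F_Suc sigma_append)
  with f show ?thesis
    by (cases c) (simp_all add: sing_eq lift_sing_def butlast_append del: of_nat_Suc)
qed

lemma sing_0: "sing 0 = [B]"
  by (simp add: singular_def F_def)

lemma sing_1: "sing (Suc 0) = [A, A]"
  unfolding sing_Suc sing_0 by (simp add: lift_sing_def)

lemma sing_2: "sing (Suc (Suc 0)) = [B, A, B]"
  unfolding sing_Suc[of "Suc 0"] sing_1 by (simp add: lift_sing_def)

lemma two_ended_sing: "two_ended (sing k)"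
proof (induction k)
  case 0
  show ?case unfolding sing_0 by (simp add: two_ended_def)
next
  case (Suc k)
  then show ?case unfolding sing_Suc using two_ended_lift by blast
qed

lemma length_sing_strict_mono: "strict_mono (\<lambda>k. length (sing k))"
  unfolding strict_mono_Suc_iff
proof
  fix k
  have "length (sing j) = length (F j)" for j
    using F_nonempty by (simp add: sing_eq)
  moreover have "length (F k) < length (F (Suc k))" using F_Suc_extends[of k] by auto
  ultimately show "length (sing k) < length (sing (Suc k))" by (simp del: of_nat_Suc)
qed

lemma singular_words_eq: "singular_words = insert [A] (range sing)"
proof -
  have "{-1..} = insert (-1) (range int)"
  proof (intro equalityI subsetI)
    fix i :: int assume "i \<in> {-1..}"
    then show "i \<in> insert (-1) (range int)"
      by (cases "i = -1") (auto intro: range_eqI[of _ _ "nat i"])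
  qed auto
  then have "singular_words = insert (singular (-1)) (range sing)"
    by (simp add: singular_words_def image_image)
  then show ?thesis by (simp add: singular_def)
qed

section \<open>Repeated singular words force longer ones\<close>

definition fib_factor :: "letter list \<Rightarrow> bool" where
  "fib_factor w \<longleftrightarrow> (\<exists>n. sublist w (F n))"

lemma fib_factor_sublist: "fib_factor u \<Longrightarrow> sublist v u \<Longrightarrow> fib_factor v"
  unfolding fib_factor_def by (meson sublist_order.order.trans)

lemma fib_factor_desubstitute:
  assumes "fib_factor w"
  obtains u where "fib_factor u" "sublist w (sigma u)"
proof -
  obtain n where "sublist w (F n)" using assms by (auto simp: fib_factor_def)
  moreover have "sublist (F n) (F (Suc n))" by (simp add: F_prefix prefix_imp_sublist)
  ultimately have "sublist w (sigma (F n))"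
    unfolding F_Suc by (meson sublist_order.order.trans)
  then show ?thesis using that[of "F n"] by (auto simp: fib_factor_def)
qed

text \<open>Factors of the infinite word lie in a finite \<open>F\<^sub>n\<close>, since each \<open>F\<^sub>n\<close> is a prefix of the limit
  and is longer than \<open>n\<close>. This replaces positions in an infinite word by finite words, on which
  \<open>\<sigma>\<close> acts.\<close>

lemma seq_factor_fib_factor:
  assumes "seq_factor w F_inf"
  shows "fib_factor w"
proof -
  obtain i where i: "w = map F_inf [i..<i + length w]"
    using assms by (auto simp: seq_factor_def)
  let ?n = "i + length w"
  have F: "F_inf j = F ?n ! j" if "j < ?n" for j
    using F_prefix[of j ?n] that length_F[of j]
    by (auto simp: F_inf_eq prefix_def nth_append)
  have "w = take (length w) (drop i (F ?n))"
  proof (rule nth_equalityI)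
    show "length w = length (take (length w) (drop i (F ?n)))"
      using length_F[of ?n] by simp
    fix j assume j: "j < length w"
    have "w ! j = F_inf (i + j)" by (subst i) (use j in simp)
    then show "w ! j = take (length w) (drop i (F ?n)) ! j"
      using j F[of "i + j"] length_F[of ?n] by simp
  qed
  then have "sublist w (F ?n)"
    by (metis sublist_drop sublist_order.order.trans sublist_take)
  then show ?thesis by (auto simp: fib_factor_def)
qed

lemma fib_factor_no_BB: "\<not> fib_factor (p @ B # B # q)"
proof
  assume "fib_factor (p @ B # B # q)"
  then obtain u where "sublist (p @ B # B # q) (sigma u)"
    using fib_factor_desubstitute by blast
  then obtain r s where "sigma u = (r @ p) @ B # (B # q @ s)"
    by (auto simp: sublist_def)
  from sigma_isolates_B(2)[OF this] show False by simp
qed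

text \<open>The recurrence property of singular words, by desubstitution down to \<open>s\<^sub>0 = b\<close>. For
  \<open>s\<^sub>-\<^sub>1 = a\<close> the analogue gives no longer word, as \<open>aba\<close> shows.\<close>

lemma repeated_sing:
  assumes "fib_factor w" "w = sing k @ y" "w = z @ sing k" "z \<noteq> []"
  shows "sublist (sing (Suc k)) w \<or> sublist (sing (Suc (Suc k))) w"
  using assms
proof (induction k arbitrary: w y z)
  case 0
  have w: "w = B # y" "w = z @ [B]" using "0.prems" unfolding sing_0 by auto
  then obtain z' where y: "y = z' @ [B]" using "0.prems"(4) by (cases z) auto
  have nBB: "\<not> fib_factor (B # B # q)" for q using fib_factor_no_BB[of "[]"] by simp
  \<comment> \<open>The letter after the first \<open>b\<close> is \<open>a\<close>; the one after that gives \<open>bab\<close> or \<open>aa\<close>.\<close>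
  have "hd y = A"
  proof (cases "hd y")
    case B
    then have "y = B # tl y" using y by (metis Nil_is_append_conv list.collapse list.distinct(1))
    with w(1) "0.prems"(1) nBB[of "tl y"] show ?thesis by simp
  qed
  with y obtain c r where "y = A # c # r" by (cases z'; cases "tl z'") auto
  then have "w = [] @ [B, A, B] @ r \<or> w = [B] @ [A, A] @ r"
    using w by (cases c) auto
  then show ?case unfolding sing_1 sing_2 by (metis sublist_appendI)
next
  case (Suc k)
  obtain u where u: "fib_factor u" "sublist w (sigma u)"
    using fib_factor_desubstitute Suc.prems(1) by blast
  obtain v y' z' where v: "sublist v u" "w = lift_sing v" "v = sing k @ y'" "v = z' @ sing k" "z' \<noteq> []"
    using lift_sing_desubstitute[OF u(2) two_ended_sing Suc.prems(2-4)[unfolded sing_Suc]] by blast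
  have ne: "sing k \<noteq> []" "hd (sing k) = last (sing k)"
    using two_ended_sing[of k] by (auto simp only: two_ended_def)
  have "hd v = hd (sing k)" unfolding v(3) by (rule hd_append2[OF ne(1)])
  moreover have "last v = last (sing k)" unfolding v(4) by (rule last_appendR[OF ne(1)])
  moreover have "v \<noteq> []" unfolding v(3) using ne(1) by simp
  ultimately have "two_ended v" using ne(2) by (auto simp only: two_ended_def)
  then have "sublist (sing j) v \<Longrightarrow> sublist (sing (Suc j)) w" for j
    unfolding sing_Suc v(2) using lift_sing_mono two_ended_sing by blast
  with Suc.IH[OF fib_factor_sublist[OF u(1) v(1)] v(3-5)] show ?case by blast
qed

text \<open>Two occurrences span a window that begins and ends with \<open>s\<^sub>k\<close>, to which
  \<open>repeated_sing\<close> applies, whether or not the occurrences overlap.\<close>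

lemma longest_sing_occurs_once:
  assumes "fib_factor w"
    and "\<not> sublist (sing (Suc k)) w" and "\<not> sublist (sing (Suc (Suc k))) w"
    and "w = p @ sing k @ q" and "w = p' @ sing k @ q'"
  shows "p = p'"
proof -
  have no: False if r: "w = r @ sing k @ t" and r': "w = r' @ sing k @ t'" and lt: "length r < length r'" for r r' t t'
  proof -
    obtain z where z: "r' = r @ z" using r lt
      unfolding r' by (auto simp: append_eq_append_conv2)
    with r r' lt have ne: "z \<noteq> []" and eq: "sing k @ t = z @ sing k @ t'" by auto
    let ?v = "z @ sing k"
    have "prefix (sing k) ?v"
    proof (rule prefix_length_prefix)
      show "prefix (sing k) (sing k @ t)" by simp
      show "prefix ?v (sing k @ t)" unfolding eq by simp
    qed simp
    then obtain y where y: "?v = sing k @ y" by (auto simp: prefix_def)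
    have v: "sublist ?v w" unfolding r' z by (metis append.assoc sublist_appendI)
    from repeated_sing[OF fib_factor_sublist[OF assms(1) v] y refl ne] v assms(2,3)
    show False by (meson sublist_order.order.trans)
  qed
  have "length p = length p'" using no[OF assms(4,5)] no[OF assms(5,4)] nat_neq_iff by blast
  then show ?thesis using assms(5) unfolding assms(4) by simp
qed

section \<open>The singular kernel\<close>

text \<open>Without \<open>aa\<close> and \<open>bb\<close> the letters alternate, and alternation over four letters
  produces \<open>bab\<close>. So a word of length at least four contains one of the three patterns among its
  first four letters.\<close>

lemma fib_factor_small:
  assumes "fib_factor w" "\<not> sublist [A, A] w" "\<not> sublist [B, A, B] w"
  shows "w \<in> {[], [A], [B], [A, B], [B, A], [A, B, A]}"
proof -
  have AA: "w \<noteq> p @ A # A # q" for p q using assms(2) by (auto simp: sublist_def)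
  have BB: "w \<noteq> p @ B # B # q" for p q using assms(1) fib_factor_no_BB by blast
  have BAB: "w \<noteq> p @ B # A # B # q" for p q using assms(3) by (auto simp: sublist_def)
  show ?thesis
  proof (cases w)
    case (Cons a w1)
    show ?thesis
    proof (cases w1)
      case w1: (Cons b w2)
      show ?thesis
      proof (cases w2)
        case w2: (Cons c w3)
        show ?thesis
        proof (cases w3)
          case Nil
          then show ?thesis using Cons w1 w2 AA[of "[]"] AA[of "[a]"] BB[of "[]"] BB[of "[a]"] BAB[of "[]"]
            by (cases a; cases b; cases c) auto
        next
          case (Cons d w4)
          then show ?thesis using \<open>w = a # w1\<close> w1 w2 AA[of "[]"] AA[of "[a]"] AA[of "[a,b]"]
              BB[of "[]"] BB[of "[a]"] BB[of "[a,b]"] BAB[of "[]"] BAB[of "[a]"]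
            by (cases a; cases b; cases c; cases d) auto
        qed
      qed (use Cons AA[of "[]"] BB[of "[]"] w1 in \<open>cases a; cases b; auto\<close>)
    qed (use Cons in \<open>cases a; auto\<close>)
  qed simp
qed

text \<open>A factor containing \<open>aa\<close> or \<open>bab\<close> has a largest index \<open>k \<ge> 1\<close> for which it contains
  \<open>s\<^sub>k\<close>; then \<open>s\<^sub>k\<close> is longer than \<open>a\<close> and than every earlier singular word, and it cannot
  recur. Otherwise the factor is a single letter and is its own kernel.\<close>

lemma kernel_exists_occurring_once:
  assumes "fib_factor w" and "w \<notin> {[], [A, B], [B, A], [A, B, A]}"
  obtains s where "\<And>t. is_singular_kernel t w \<longleftrightarrow> t = s"
    and "\<And>p q p' q'. w = p @ s @ q \<Longrightarrow> w = p' @ s @ q' \<Longrightarrow> p = p'"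
proof (cases "sublist [A, A] w \<or> sublist [B, A, B] w")
  case True
  let ?K = "{k. sublist (sing k) w}"
  have mono: "length (sing i) < length (sing j) \<longleftrightarrow> i < j" for i j
    using strict_mono_less[OF length_sing_strict_mono] .
  have bound: "k \<le> length w" if "k \<in> ?K" for k
    using that strict_mono_imp_increasing[OF length_sing_strict_mono, of k] sublist_length_le[of "sing k" w]
    by simp
  then have fin: "finite ?K" by (meson finite_nat_set_iff_bounded_le)
  have ge1: "\<exists>k \<in> ?K. 1 \<le> k" using True unfolding sing_1[symmetric] sing_2[symmetric]
    by (metis One_nat_def le_add1 mem_Collect_eq plus_1_eq_Suc)
  define k where "k = Max ?K"
  have k: "k \<in> ?K" unfolding k_def using fin ge1 by (intro Max_in) auto
  have max: "j \<le> k" if "j \<in> ?K" for j unfolding k_def using fin that by simp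
  have "1 \<le> k" using ge1 max by force
  then have len: "1 < length (sing k)" using mono[of 0 k] unfolding sing_0 by simp
  have ker: "is_singular_kernel t w \<longleftrightarrow> t = sing k" for t
  proof
    assume t: "is_singular_kernel t w"
    then have le: "length (sing k) \<le> length t" and "t \<in> singular_words" "sublist t w"
      using k by (auto simp: is_singular_kernel_def singular_words_eq)
    with len obtain j where j: "t = sing j" by (auto simp: singular_words_eq)
    with \<open>sublist t w\<close> max have "j \<le> k" by simp
    moreover have "\<not> j < k" using mono[of j k] le j by simp
    ultimately show "t = sing k" using j by simp
  next
    have "length t \<le> length (sing k)" if "t \<in> singular_words" "sublist t w" for t
    proof (cases "t = [A]")
      case False
      with that(1) obtain j where j: "t = sing j" by (auto simp: singular_words_eq)
      with that(2) max[of j] have "\<not> k < j" by simp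
      with mono[of k j] j show ?thesis by simp
    qed (use len in simp)
    moreover assume "t = sing k"
    ultimately show "is_singular_kernel t w"
      using k by (auto simp: is_singular_kernel_def singular_words_eq)
  qed
  have "\<not> sublist (sing (Suc k)) w" "\<not> sublist (sing (Suc (Suc k))) w"
    using max[of "Suc k"] max[of "Suc (Suc k)"] by (auto simp del: of_nat_Suc)
  with longest_sing_occurs_once[OF assms(1)] ker that[of "sing k"] show ?thesis by blast
next
  case False
  with fib_factor_small[OF assms(1)] assms(2) have w: "w = [A] \<or> w = [B]" by auto
  have sub: "sublist t w \<longleftrightarrow> t = [] \<or> t = w" for t
    using w by (auto simp: sublist_Cons_right prefix_Cons)
  have "[B] \<in> singular_words" unfolding singular_words_eq sing_0[symmetric] by blast
  then have "w \<in> singular_words" using w by (auto simp: singular_words_eq)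
  moreover have "[] \<notin> singular_words"
  proof
    assume "[] \<in> singular_words"
    then obtain k where "sing k = []" unfolding singular_words_eq by (metis imageE insertE list.distinct(1))
    then show False using two_ended_sing[of k] by (simp add: two_ended_def)
  qed
  ultimately have "is_singular_kernel t w \<longleftrightarrow> t = w" for t
    by (auto simp: is_singular_kernel_def sub)
  moreover have "p = []" if "w = p @ w @ q" for p q
    using arg_cong[OF that, of length] by simp
  ultimately show ?thesis using that[of w] by blast
qed

lemma occurs_at_iff: "occurs_at v w i \<longleftrightarrow> (\<exists>p q. w = p @ v @ q \<and> length p = i)"
proof
  assume "occurs_at v w i"
  then have "take i w @ v @ drop (i + length v) w = w" "i \<le> length w"
    unfolding occurs_at_def
    by (metis append_take_drop_id drop_drop add.commute, simp)
  then show "\<exists>p q. w = p @ v @ q \<and> length p = i"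
    by (intro exI[of _ "take i w"] exI[of _ "drop (i + length v) w"]) simp
qed (auto simp: occurs_at_def)

theorem proposition1p5:
  fixes w :: "letter list"
  assumes "seq_factor w F_inf"
    and "w \<notin> {[], [A, B], [B, A], [A, B, A]}"
  shows "(\<exists>!s. is_singular_kernel s w) \<and> (\<exists>!i. occurs_at (sk w) w i) \<and>
    (\<exists>!(m1, m2). w = m1 @ sk w @ m2)"
proof -
  obtain s where ker: "\<And>t. is_singular_kernel t w \<longleftrightarrow> t = s"
    and once: "\<And>p q p' q'. w = p @ s @ q \<Longrightarrow> w = p' @ s @ q' \<Longrightarrow> p = p'"
    using kernel_exists_occurring_once[OF seq_factor_fib_factor[OF assms(1)] assms(2)] by blast
  have sk: "sk w = s" by (simp add: sk_def ker)
  have "sublist s w" using ker by (auto simp: is_singular_kernel_def)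
  then obtain p q where w: "w = p @ s @ q" by (auto simp: sublist_def)
  have "\<exists>!t. is_singular_kernel t w" by (simp add: ker)
  moreover have "\<exists>!i. occurs_at s w i"
    unfolding occurs_at_iff
  proof (rule ex1I[of _ "length p"])
    show "\<exists>p' q. w = p' @ s @ q \<and> length p' = length p" using w by blast
    show "i = length p" if "\<exists>p' q. w = p' @ s @ q \<and> length p' = i" for i
      using that once[OF _ w] by blast
  qed
  moreover have "\<exists>!(m1, m2). w = m1 @ s @ m2"
  proof (rule ex1I[of _ "(p, q)"])
    fix m :: "letter list \<times> letter list"
    assume "case m of (m1, m2) \<Rightarrow> w = m1 @ s @ m2"
    then obtain m1 m2 where m: "m = (m1, m2)" "w = m1 @ s @ m2" by (cases m) auto
    have "m1 = p" using once[OF m(2) w] .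
    with m w show "m = (p, q)" by simp
  qed (use w in simp)
  ultimately show ?thesis by (simp add: sk)
qed

end
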